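(* Let $X$ be a real analytic vector field on an open neighbourhood $U\subseteq\mathbb{R}^2$ of the origin such that: (1) the axis $\{y=0\}$ is invariant for $X$, i.e. the second component of $X$ has the form $y\,G(x,y)$ with $G$ analytic; (2) $X=R\,X_I$ on $U\setminus\{y=0\}$, with $X_I=(\partial_yI,-\partial_xI)$, for some first integral $I$ of $X$ and some function $R$, both analytic on $U\setminus\{y=0\}$, where $\{R=0\}\subseteq\{y=0\}$ (i.e. $R$ has no zeros off the axis). Let $p\in U$ be an isolated equilibrium of $X$ with $DX(p)$ nilpotent and nonzero. Then: (i) if $p\notin\{y=0\}$, then $b=0$; (ii) if $p\in\{y=0\}$, then $a=0$ and $\mu_p(X)\ge 3$. In either case $ab=0$; consequently the two-parameter Bogdanov--Takens unfolding is not versal at $p$ within the class of vector fields satisfying (1) and (2).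
   Context: For a planar analytic vector field $X$ with $X(p)=0$ and $DX(p)$ nilpotent and nonzero, let $q_0$ span $\ker DX(p)$ and put $$a=-\tfrac12 D_{q_0}(\det DX)(p),\qquad b=D_{q_0}(\operatorname{tr}DX)(p),$$ where $D_qh(p)=\langle\nabla h(p),q\rangle$. These are (up to the normalization of $q_0$, which does not affect vanishing) the quadratic coefficients of the Bogdanov--Takens normal form $\dot\xi_1=\xi_2$, $\dot\xi_2=a\xi_1^2+b\xi_1\xi_2+O(\|\xi\|^3)$. In the usage of this statement, the two-parameter Bogdanov--Takens unfolding at $p$ is versal precisely when $ab\neq0$. The multiplicity $\mu_p(X)$ is the local intersection number at $p$ of the two components of $X$, i.e. the dimension over $\mathbb{C}$ of the ring of convergent complex power series centred at $p$ modulo the ideal generated by the two components. *)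

theory Defs
  imports
    "HOL-Analysis.Analysis"
    "HOL-Algebra.Embedded_Algebras"
    "HOL-Algebra.QuotRing"
    "HOL-Computational_Algebra.Formal_Power_Series"
    "HOL-Library.Extended_Nat"
begin

section \<open>Real analytic functions of two variables\<close>

text \<open>
  Power series in two variables are iterated formal power series; the coefficient of
  \<open>x\<^sup>i y\<^sup>j\<close> is \<open>fps_nth (fps_nth F i) j\<close>.
\<close>

definition has_power_series :: "(real^2 \<Rightarrow> real) \<Rightarrow> real^2 \<Rightarrow> real fps fps \<Rightarrow> bool" where
  "has_power_series f p F \<longleftrightarrow>
     (\<forall>\<^sub>F h in nhds 0.
        ((\<lambda>(i, j). fps_nth (fps_nth F i) j * (h $ 1) ^ i * (h $ 2) ^ j) has_sum f (p + h)) UNIV)"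

definition real_analytic_on :: "(real^2 \<Rightarrow> real) \<Rightarrow> (real^2) set \<Rightarrow> bool" where
  "real_analytic_on f S \<longleftrightarrow> (\<forall>p\<in>S. \<exists>F. has_power_series f p F)"

definition analytic_vector_field_on :: "(real^2 \<Rightarrow> real^2) \<Rightarrow> (real^2) set \<Rightarrow> bool" where
  "analytic_vector_field_on X S \<longleftrightarrow> (\<forall>k. real_analytic_on (\<lambda>z. X z $ k) S)"


section \<open>First integrals\<close>

definition x_axis :: "(real^2) set" where
  "x_axis = {z. z $ 2 = 0}"

definition hamiltonian_field :: "(real^2 \<Rightarrow> real) \<Rightarrow> real^2 \<Rightarrow> real^2" where
  "hamiltonian_field I z =
     vector [frechet_derivative I (at z) (axis 2 1), - frechet_derivative I (at z) (axis 1 1)]"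

definition first_integral_on :: "(real^2 \<Rightarrow> real) \<Rightarrow> (real^2 \<Rightarrow> real^2) \<Rightarrow> (real^2) set \<Rightarrow> bool" where
  "first_integral_on I X S \<longleftrightarrow>
     (\<forall>z\<in>S. frechet_derivative I (at z) (X z) = 0) \<and> \<not> I constant_on S"


section \<open>Bogdanov--Takens coefficients\<close>

definition nilpotent_map :: "('a::zero \<Rightarrow> 'a) \<Rightarrow> bool" where
  "nilpotent_map L \<longleftrightarrow> (\<exists>k. L ^^ k = (\<lambda>_. 0))"

definition spans_kernel :: "(real^2 \<Rightarrow> real^2) \<Rightarrow> real^2 \<Rightarrow> real^2 \<Rightarrow> bool" where
  "spans_kernel X p q \<longleftrightarrow> span {q} = {v. frechet_derivative X (at p) v = 0}"

definition bt_a :: "(real^2 \<Rightarrow> real^2) \<Rightarrow> real^2 \<Rightarrow> real^2 \<Rightarrow> real" where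
  "bt_a X p q = - (1/2) * frechet_derivative (\<lambda>z. det (jacobian X (at z))) (at p) q"

definition bt_b :: "(real^2 \<Rightarrow> real^2) \<Rightarrow> real^2 \<Rightarrow> real^2 \<Rightarrow> real" where
  "bt_b X p q = frechet_derivative (\<lambda>z. trace (jacobian X (at z))) (at p) q"

text \<open>
  Versality of the two-parameter Bogdanov--Takens unfolding is understood here as nondegeneracy
  of the quadratic part of the normal form. Rescaling \<open>q\<close> by \<open>c\<close> multiplies both coefficients by
  \<open>c\<close>, so the choice of the spanning vector is irrelevant.
\<close>

definition bt_unfolding_versal :: "(real^2 \<Rightarrow> real^2) \<Rightarrow> real^2 \<Rightarrow> bool" where
  "bt_unfolding_versal X p \<longleftrightarrow> (\<exists>q. spans_kernel X p q \<and> bt_a X p q * bt_b X p q \<noteq> 0)"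


section \<open>Multiplicity of an equilibrium\<close>

definition convergent_series :: "complex fps fps set" where
  "convergent_series =
     {F. \<exists>r>0. (\<lambda>(i, j). norm (fps_nth (fps_nth F i) j) * r ^ (i + j)) summable_on UNIV}"

definition convergent_ring :: "complex fps fps ring" where
  "convergent_ring =
     \<lparr>carrier = convergent_series, monoid.mult = (*), one = 1, zero = 0, add = (+)\<rparr>"

text \<open>The Taylor series at \<open>p\<close>, which is unique if it exists, with coefficients viewed in \<open>\<complex>\<close>.\<close>

definition complex_germ :: "(real^2 \<Rightarrow> real) \<Rightarrow> real^2 \<Rightarrow> complex fps fps" where
  "complex_germ f p =
     (let F = (THE F. has_power_series f p F)
      in Abs_fps (\<lambda>i. Abs_fps (\<lambda>j. complex_of_real (fps_nth (fps_nth F i) j))))"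

definition component_ideal :: "(real^2 \<Rightarrow> real^2) \<Rightarrow> real^2 \<Rightarrow> complex fps fps set" where
  "component_ideal X p =
     Idl\<^bsub>convergent_ring\<^esub> {complex_germ (\<lambda>z. X z $ 1) p, complex_germ (\<lambda>z. X z $ 2) p}"

definition local_algebra :: "(real^2 \<Rightarrow> real^2) \<Rightarrow> real^2 \<Rightarrow> complex fps fps set ring" where
  "local_algebra X p = convergent_ring Quot component_ideal X p"

text \<open>The copy of \<open>\<complex>\<close> inside the local algebra: the classes of the constant series.\<close>

definition scalars :: "(real^2 \<Rightarrow> real^2) \<Rightarrow> real^2 \<Rightarrow> complex fps fps set set" where
  "scalars X p =
     range (\<lambda>c. component_ideal X p +>\<^bsub>convergent_ring\<^esub> fps_const (fps_const c))"

definition multiplicity_at :: "(real^2 \<Rightarrow> real^2) \<Rightarrow> real^2 \<Rightarrow> enat" where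
  "multiplicity_at X p =
     (let A = local_algebra X p; has_dim = (\<lambda>n. ring.dimension A n (scalars X p) (carrier A))
      in if \<exists>n. has_dim n then enat (THE n. has_dim n) else \<infinity>)"

end

theory Submission
  imports Defs
begin

text \<open>
  The two assertions are independent computations, one for each position of \<open>p\<close>.

  Off the axis, \<open>X = R X\<^sub>I\<close> near \<open>p\<close> with \<open>R \<noteq> 0\<close>. Hamiltonian fields have divergence zero, so
  \<open>tr DX = div X = R\<^sub>x I\<^sub>y - R\<^sub>y I\<^sub>x\<close>. As \<open>X\<close> vanishes at \<open>p\<close>, so do \<open>I\<^sub>x\<close> and \<open>I\<^sub>y\<close>, and as \<open>q\<^sub>0\<close> spans the kernel
  of \<open>DX(p)\<close>, their derivatives in the direction \<open>q\<^sub>0\<close> vanish at \<open>p\<close>, too. Therefore \<open>b = D\<^sub>q(tr DX)(p) = 0\<close>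
  for \<open>q = q\<^sub>0\<close> (\<open>bt_b_conformally_hamiltonian\<close>).

  On the axis, write \<open>X = (f, y G)\<close>. The matrix \<open>DX(p)\<close> is upper triangular, so nilpotency and \<open>DX(p) \<noteq> 0\<close>
  mean \<open>f\<^sub>x(p) = G(p) = 0\<close> and \<open>f\<^sub>y(p) \<noteq> 0\<close> (\<open>invariant_axis_nilpotent\<close>), and the kernel is the direction of
  the axis. Along it \<open>det DX = f\<^sub>x G\<close>, a product of two functions vanishing at \<open>p\<close>, whence \<open>a = 0\<close>
  (\<open>bt_a_invariant_axis\<close>).

  For the multiplicity, the curve \<open>f = 0\<close> is tangent to the axis and agrees to second order with a
  parabola \<open>y = l x\<^sup>2\<close> (in coordinates centred at \<open>p\<close>). On this parabola \<open>f\<close> is \<open>O(x\<^sup>3)\<close>, and so is \<open>y G\<close>,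
  as \<open>G(p) = 0\<close>. Restriction to the parabola thus induces a surjection from the local algebra onto
  \<open>\<complex>[x] / (x\<^sup>3)\<close>, which has dimension \<open>3\<close> (\<open>dimension_quotient_ge_3\<close>, \<open>multiplicity_ge_3\<close>).

  The analytic groundwork relates the coefficients of a convergent double series to Frechet
  derivatives: the sum is differentiable at the centre, its partial derivatives are again sums of
  power series, and the series is determined by the function. The last fact identifies the germs of
  the components of \<open>X\<close>, which are defined as the Taylor series by a definite description.
\<close>

section \<open>Double power series\<close>

text \<open>
  For fixed \<open>y\<close> the sum over \<open>j\<close> turns the double series into a power series in \<open>x\<close>, which may be
  differentiated termwise. This yields the derivative only as an iterated sum; it is the unordered
  double sum because \<open>(i + 1) \<bar>x\<bar>\<^sup>i\<close> is at most a constant times \<open>\<rho>\<^sup>i\<^sup>+\<^sup>1\<close> for a radius \<open>\<rho>\<close> strictly between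
  \<open>\<bar>x\<bar>\<close> and \<open>r\<close>, so that the original series at \<open>\<rho>\<close> dominates the differentiated one.
\<close>

lemma double_series_partial:
  fixes c :: "nat \<Rightarrow> nat \<Rightarrow> real" and g :: "real \<Rightarrow> real \<Rightarrow> real"
  assumes g: "\<And>x y. \<bar>x\<bar> < r \<Longrightarrow> \<bar>y\<bar> < r \<Longrightarrow> ((\<lambda>(i, j). c i j * x ^ i * y ^ j) has_sum g x y) UNIV"
    and x: "\<bar>x\<bar> < r" and y: "\<bar>y\<bar> < r"
  obtains D where "((\<lambda>t. g t y) has_real_derivative D) (at x)"
    and "((\<lambda>(i, j). real (Suc i) * c (Suc i) j * x ^ i * y ^ j) has_sum D) UNIV"
proof -
  define \<rho> where "\<rho> = (\<bar>x\<bar> + r) / 2"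
  have \<rho>: "0 < \<rho>" "\<bar>x\<bar> < \<rho>" "\<rho> < r" "\<bar>\<rho>\<bar> < r"
    using x by (auto simp: \<rho>_def)
  define a where "a i = infsum (\<lambda>j. c i j * y ^ j) UNIV" for i
  have sum_\<rho>: "(\<lambda>(i, j). c i j * \<rho> ^ i * y ^ j) summable_on UNIV"
    using g[OF \<rho>(4) y] has_sum_imp_summable by blast
  have inner: "((\<lambda>j. c i j * y ^ j) has_sum a i) UNIV" for i
  proof -
    have "(\<lambda>(i, j). c i j * \<rho> ^ i * y ^ j) summable_on UNIV \<times> UNIV"
      using sum_\<rho> by simp
    then have "(\<lambda>j. c i j * \<rho> ^ i * y ^ j) summable_on UNIV"
      by (rule summable_on_SigmaD1) simp
    then have "(\<lambda>j. inverse (\<rho> ^ i) * (c i j * \<rho> ^ i * y ^ j)) summable_on UNIV"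
      by (rule summable_on_cmult_right)
    moreover have "inverse (\<rho> ^ i) * (c i j * \<rho> ^ i * y ^ j) = c i j * y ^ j" for j
      using \<rho> by (simp add: field_simps)
    ultimately show ?thesis
      unfolding a_def by simp
  qed
  have outer: "(\<lambda>i. a i * z ^ i) sums g z y" if "\<bar>z\<bar> < r" for z
  proof -
    have "((\<lambda>(i, j). c i j * z ^ i * y ^ j) has_sum g z y) (UNIV \<times> UNIV)"
      using g[OF that y] by simp
    moreover have "((\<lambda>j. case (i, j) of (i, j) \<Rightarrow> c i j * z ^ i * y ^ j) has_sum a i * z ^ i) UNIV" for i
      using has_sum_cmult_right[OF inner[of i], of "z ^ i"] by (simp add: mult_ac)
    ultimately have "((\<lambda>i. a i * z ^ i) has_sum g z y) UNIV"
      by (rule has_sum_SigmaD)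
    then show ?thesis
      by (rule has_sum_imp_sums)
  qed
  define D where "D = (\<Sum>n. diffs a n * x ^ n)"
  have "((\<lambda>z. \<Sum>n. a n * z ^ n) has_real_derivative D) (at x)"
    unfolding D_def
  proof (rule termdiffs_strong'[where K = r])
    show "summable (\<lambda>n. a n * z ^ n)" if "norm z < r" for z
      using outer[of z] that sums_summable by force
  qed (use x in simp)
  then have "((\<lambda>t. g t y) has_real_derivative D) (at x)"
  proof (rule has_field_derivative_transform_within_open[where S = "{-r<..<r}"])
    show "(\<Sum>n. a n * z ^ n) = g z y" if "z \<in> {-r<..<r}" for z
      using outer[of z] that by (auto simp: sums_iff)
  qed (use x in auto)
  moreover have "((\<lambda>(i, j). real (Suc i) * c (Suc i) j * x ^ i * y ^ j) has_sum D) UNIV"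
  proof -
    let ?S = "\<lambda>(i, j). real (Suc i) * c (Suc i) j * x ^ i * y ^ j"
    let ?q = "\<bar>x\<bar> / \<rho>"
    have q: "0 \<le> ?q" "?q < 1"
      using \<rho> by auto
    have "(\<lambda>n. of_nat n * ?q ^ n) \<longlonglongrightarrow> 0"
      using powser_times_n_limit_0[of ?q] q by simp
    then have "Bseq (\<lambda>n. of_nat n * ?q ^ n)"
      using convergentI convergent_imp_Bseq by blast
    then obtain B where B: "\<And>n. norm (of_nat n * ?q ^ n) \<le> B"
      by (auto simp: Bseq_def)
    \<comment> \<open>As \<open>n q\<^sup>n \<rightarrow> 0\<close> for \<open>q = \<bar>x\<bar> / \<rho> < 1\<close>, this sequence is bounded by some \<open>B\<close>; in
      \<open>(i + 1) q\<^sup>i\<close> the extra summand \<open>q\<^sup>i\<close> is at most \<open>1\<close>.\<close>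
    have bound: "real (Suc i) * \<bar>x\<bar> ^ i \<le> (B + 1) / \<rho> * \<rho> ^ Suc i" for i
    proof -
      have "real (Suc i) * ?q ^ i = real i * ?q ^ i + ?q ^ i"
        by (simp add: algebra_simps)
      also have "\<dots> \<le> B + 1"
        using B[of i] power_le_one[of ?q i] q by (intro add_mono) (auto simp: abs_mult)
      finally have "real (Suc i) * ?q ^ i * \<rho> ^ i \<le> (B + 1) * \<rho> ^ i"
        using \<rho> by (intro mult_right_mono) auto
      then show ?thesis
        using \<rho> by (simp add: power_divide)
    qed
    have "(\<lambda>(i, j). c i j * \<rho> ^ i * y ^ j) summable_on range (\<lambda>(i, j). (Suc i, j))"
      using sum_\<rho> summable_on_subset_banach by blast
    moreover have "inj (\<lambda>(i :: nat, j :: nat). (Suc i, j))"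
      by (auto simp: inj_def)
    ultimately have "(\<lambda>(i, j). c (Suc i) j * \<rho> ^ Suc i * y ^ j) summable_on UNIV"
      by (simp add: summable_on_reindex o_def case_prod_unfold)
    then have "(\<lambda>p. norm (case p of (i, j) \<Rightarrow> c (Suc i) j * \<rho> ^ Suc i * y ^ j)) summable_on UNIV"
      using summable_on_iff_abs_summable_on_real by blast
    then have "(\<lambda>p. (B + 1) / \<rho> * norm (case p of (i, j) \<Rightarrow> c (Suc i) j * \<rho> ^ Suc i * y ^ j)) summable_on UNIV"
      by (rule summable_on_cmult_right)
    then have "(\<lambda>p. norm (?S p)) summable_on UNIV"
    proof (rule Infinite_Sum.abs_summable_on_comparison_test')
      fix p :: "nat \<times> nat"
      obtain i j where p: "p = (i, j)"
        by (cases p)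
      have "norm (?S p) = real (Suc i) * \<bar>x\<bar> ^ i * (\<bar>c (Suc i) j\<bar> * \<bar>y\<bar> ^ j)"
        by (simp add: p abs_mult power_abs)
      also have "\<dots> \<le> (B + 1) / \<rho> * \<rho> ^ Suc i * (\<bar>c (Suc i) j\<bar> * \<bar>y\<bar> ^ j)"
        by (intro mult_right_mono bound) auto
      also have "\<dots> = (B + 1) / \<rho> * norm (case p of (i, j) \<Rightarrow> c (Suc i) j * \<rho> ^ Suc i * y ^ j)"
        using \<rho> by (simp add: p abs_mult power_abs)
      finally show "norm (?S p) \<le> \<dots>" .
    qed
    then have "?S summable_on UNIV"
      using summable_on_iff_abs_summable_on_real by blast
    then obtain s where s: "(?S has_sum s) UNIV"
      by (auto simp: summable_on_def)
    have "((\<lambda>j. ?S (i, j)) has_sum diffs a i * x ^ i) UNIV" for i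
      using has_sum_cmult_right[OF inner[of "Suc i"], of "real (Suc i) * x ^ i"]
      by (simp add: mult_ac diffs_def)
    then have "((\<lambda>i. diffs a i * x ^ i) has_sum s) UNIV"
      using has_sum_SigmaD[of ?S UNIV "\<lambda>_. UNIV" s "\<lambda>i. diffs a i * x ^ i"] s by simp
    then have "s = D"
      unfolding D_def using has_sum_imp_sums sums_unique by blast
    with s show ?thesis
      by simp
  qed
  ultimately show thesis
    using that by blast
qed

text \<open>
  Each term of total degree at least \<open>2\<close> loses at least the factor \<open>(t / r)\<^sup>2\<close> when the radius shrinks
  from \<open>r\<close> to \<open>t\<close>. This quadratic estimate is what makes a sum differentiable in both variables jointly.
\<close>

lemma double_series_remainder:
  fixes c :: "nat \<Rightarrow> nat \<Rightarrow> real"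
  assumes r: "0 < r" and sum: "(\<lambda>(i, j). \<bar>c i j\<bar> * r ^ (i + j)) summable_on UNIV"
  obtains M where "\<And>x y s t. \<bar>x\<bar> \<le> t \<Longrightarrow> \<bar>y\<bar> \<le> t \<Longrightarrow> t \<le> r \<Longrightarrow>
      ((\<lambda>(i, j). c i j * x ^ i * y ^ j) has_sum s) UNIV \<Longrightarrow>
      \<bar>s - (c 0 0 + c 1 0 * x + c 0 1 * y)\<bar> \<le> M * t\<^sup>2"
proof
  let ?u = "\<lambda>(i, j). \<bar>c i j\<bar> * r ^ (i + j)"
  fix x y s t
  assume xt: "\<bar>x\<bar> \<le> t" and yt: "\<bar>y\<bar> \<le> t" and tr: "t \<le> r"
    and s: "((\<lambda>(i, j). c i j * x ^ i * y ^ j) has_sum s) UNIV"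
  let ?L = "{(0, 0), (1, 0), (0, 1)} :: (nat \<times> nat) set"
  let ?w = "\<lambda>(i, j). c i j * x ^ i * y ^ j"
  have "(?w has_sum sum ?w ?L) ?L"
    by (rule has_sum_finite) simp
  from has_sum_Diff[OF s this]
  have rest: "(?w has_sum (s - (c 0 0 + c 1 0 * x + c 0 1 * y))) (UNIV - ?L)"
    by (simp add: algebra_simps)
  have u: "(?u has_sum infsum ?u (UNIV - ?L)) (UNIV - ?L)"
    using summable_on_subset_banach[OF sum] by simp
  have "norm (s - (c 0 0 + c 1 0 * x + c 0 1 * y)) \<le> (t / r)\<^sup>2 * infsum ?u (UNIV - ?L)"
  proof (rule norm_infsum_le[OF rest has_sum_cmult_right[OF u]])
    fix p assume p: "p \<in> UNIV - ?L"
    obtain i j where ij: "p = (i, j)"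
      by (cases p)
    have deg: "2 \<le> i + j"
      using p by (auto simp: ij)
    have t: "0 \<le> t"
      using xt by simp
    have "norm (?w p) = \<bar>c i j\<bar> * (\<bar>x\<bar> ^ i * \<bar>y\<bar> ^ j)"
      by (simp add: ij abs_mult power_abs)
    also have "\<dots> \<le> \<bar>c i j\<bar> * (t ^ i * t ^ j)"
      using xt yt t by (intro mult_left_mono mult_mono power_mono) auto
    also have "\<dots> = \<bar>c i j\<bar> * r ^ (i + j) * (t / r) ^ (i + j)"
      using r by (simp add: power_add power_divide)
    also have "\<dots> \<le> \<bar>c i j\<bar> * r ^ (i + j) * (t / r)\<^sup>2"
      using r t tr deg by (intro mult_left_mono power_decreasing) auto
    finally show "norm (?w p) \<le> (t / r)\<^sup>2 * ?u p"
      by (simp add: ij mult_ac)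
  qed
  then show "\<bar>s - (c 0 0 + c 1 0 * x + c 0 1 * y)\<bar> \<le> (infsum ?u (UNIV - ?L) / r\<^sup>2) * t\<^sup>2"
    by (simp add: power_divide mult_ac)
qed

section \<open>Functions given by a power series\<close>

abbreviation coeff2 :: "'a::zero fps fps \<Rightarrow> nat \<Rightarrow> nat \<Rightarrow> 'a" where
  "coeff2 F i j \<equiv> fps_nth (fps_nth F i) j"

lemma has_power_series_square:
  assumes "has_power_series f p F"
  obtains r where "r > 0"
    and "\<And>x y. \<bar>x\<bar> < r \<Longrightarrow> \<bar>y\<bar> < r \<Longrightarrow>
      ((\<lambda>(i, j). coeff2 F i j * x ^ i * y ^ j) has_sum f (p + vector [x, y])) UNIV"
proof -
  obtain e where e: "e > 0" and F: "\<And>h :: real^2. norm h < e \<Longrightarrow>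
      ((\<lambda>(i, j). coeff2 F i j * (h $ 1) ^ i * (h $ 2) ^ j) has_sum f (p + h)) UNIV"
    using assms unfolding has_power_series_def eventually_nhds_metric dist_norm by auto
  show thesis
  proof
    show "e / 2 > 0"
      using e by simp
    fix x y :: real
    assume "\<bar>x\<bar> < e / 2" "\<bar>y\<bar> < e / 2"
    moreover have "norm (vector [x, y] :: real^2) \<le> \<bar>x\<bar> + \<bar>y\<bar>"
      using norm_le_l1_cart[of "vector [x, y] :: real^2"] by (simp add: sum_2)
    ultimately show "((\<lambda>(i, j). coeff2 F i j * x ^ i * y ^ j) has_sum f (p + vector [x, y])) UNIV"
      using F[of "vector [x, y]"] by simp
  qed
qed

lemma has_power_seriesI_square:
  assumes "r > 0"
    and "\<And>x y. \<bar>x\<bar> < r \<Longrightarrow> \<bar>y\<bar> < r \<Longrightarrow>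
      ((\<lambda>(i, j). coeff2 F i j * x ^ i * y ^ j) has_sum f (p + vector [x, y])) UNIV"
  shows "has_power_series f p F"
  unfolding has_power_series_def eventually_nhds_metric
proof (intro exI[of _ r] conjI allI impI assms(1))
  fix h :: "real^2"
  assume "dist h 0 < r"
  then have "\<bar>h $ 1\<bar> < r" "\<bar>h $ 2\<bar> < r"
    using component_le_norm_cart[of h 1] component_le_norm_cart[of h 2] by simp_all
  moreover have "vector [h $ 1, h $ 2] = h"
    by (simp add: vec_eq_iff forall_2)
  ultimately show "((\<lambda>(i, j). coeff2 F i j * (h $ 1) ^ i * (h $ 2) ^ j) has_sum f (p + h)) UNIV"
    using assms(2)[of "h $ 1" "h $ 2"] by simp
qed

lemma has_power_series_abs_summable:
  assumes "has_power_series f p F"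
  obtains r where "r > 0" "(\<lambda>(i, j). \<bar>coeff2 F i j\<bar> * r ^ (i + j)) summable_on UNIV"
    "\<And>x y. \<bar>x\<bar> \<le> r \<Longrightarrow> \<bar>y\<bar> \<le> r \<Longrightarrow>
      ((\<lambda>(i, j). coeff2 F i j * x ^ i * y ^ j) has_sum f (p + vector [x, y])) UNIV"
proof -
  obtain r where r: "r > 0" and F: "\<And>x y. \<bar>x\<bar> < r \<Longrightarrow> \<bar>y\<bar> < r \<Longrightarrow>
      ((\<lambda>(i, j). coeff2 F i j * x ^ i * y ^ j) has_sum f (p + vector [x, y])) UNIV"
    using has_power_series_square[OF assms] by blast
  have "(\<lambda>(i, j). coeff2 F i j * (r/2) ^ i * (r/2) ^ j) summable_on UNIV"
    using F[of "r/2" "r/2"] r has_sum_imp_summable by fastforce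
  then have "(\<lambda>p. norm (case p of (i, j) \<Rightarrow> coeff2 F i j * (r/2) ^ i * (r/2) ^ j)) summable_on UNIV"
    using summable_on_iff_abs_summable_on_real by blast
  also have "(\<lambda>p. norm (case p of (i, j) \<Rightarrow> coeff2 F i j * (r/2) ^ i * (r/2) ^ j))
      = (\<lambda>(i, j). \<bar>coeff2 F i j\<bar> * (r/2) ^ (i + j))"
    using r by (auto simp: fun_eq_iff abs_mult power_add)
  finally show thesis
    using that[of "r/2"] r F by simp
qed

lemma has_power_series_center:
  assumes "has_power_series f p F"
  shows "coeff2 F 0 0 = f p"
proof -
  have "((\<lambda>(i, j). coeff2 F i j * 0 ^ i * 0 ^ j) has_sum f p) UNIV"
    using eventually_nhds_x_imp_x[OF assms[unfolded has_power_series_def]] by simp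
  moreover have "((\<lambda>(i, j). coeff2 F i j * 0 ^ i * 0 ^ j) has_sum coeff2 F 0 0) UNIV"
    by (rule has_sum_finite_neutralI[where B = "{(0, 0)}"]) auto
  ultimately show ?thesis
    using has_sum_unique by blast
qed

text \<open>
  The first-order Taylor estimate at the centre. It is applied at every point of an open set on which
  the function is analytic, each time to the series at that point, so no re-expansion of a series
  around a different point is ever required.
\<close>

lemma has_power_series_has_derivative:
  assumes "has_power_series f p F"
  shows "(f has_derivative (\<lambda>h. coeff2 F 1 0 * h $ 1 + coeff2 F 0 1 * h $ 2)) (at p)"
proof -
  let ?c = "\<lambda>i j. coeff2 F i j"
  obtain r where r: "r > 0" and sum: "(\<lambda>(i, j). \<bar>?c i j\<bar> * r ^ (i + j)) summable_on UNIV"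
    and F: "\<And>x y. \<bar>x\<bar> \<le> r \<Longrightarrow> \<bar>y\<bar> \<le> r \<Longrightarrow>
      ((\<lambda>(i, j). ?c i j * x ^ i * y ^ j) has_sum f (p + vector [x, y])) UNIV"
    using has_power_series_abs_summable[OF assms] by blast
  obtain M where M: "\<And>x y s t. \<bar>x\<bar> \<le> t \<Longrightarrow> \<bar>y\<bar> \<le> t \<Longrightarrow> t \<le> r \<Longrightarrow>
      ((\<lambda>(i, j). ?c i j * x ^ i * y ^ j) has_sum s) UNIV \<Longrightarrow>
      \<bar>s - (?c 0 0 + ?c 1 0 * x + ?c 0 1 * y)\<bar> \<le> M * t\<^sup>2"
    using double_series_remainder[OF r sum] by blast
  show ?thesis
  proof (rule has_derivativeI_sandwich[OF r, where H = "\<lambda>z. M * norm (z - p)"])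
    show "bounded_linear (\<lambda>h. ?c 1 0 * h $ 1 + ?c 0 1 * h $ 2)"
      by (intro bounded_linear_add bounded_linear_compose[OF bounded_linear_mult_right] bounded_linear_vec_nth)
    show "((\<lambda>z. M * norm (z - p)) \<longlongrightarrow> 0) (at p)"
      by (rule tendsto_eq_intros refl | simp)+
    fix z :: "real^2"
    assume z: "z \<noteq> p" "dist z p < r"
    let ?h = "z - p"
    have h: "vector [?h $ 1, ?h $ 2] = ?h"
      by (simp add: vec_eq_iff forall_2)
    have small: "\<bar>?h $ 1\<bar> \<le> norm ?h" "\<bar>?h $ 2\<bar> \<le> norm ?h" "norm ?h \<le> r"
      using component_le_norm_cart[of ?h 1] component_le_norm_cart[of ?h 2] z by (simp_all add: dist_norm)
    have "((\<lambda>(i, j). ?c i j * (?h $ 1) ^ i * (?h $ 2) ^ j) has_sum f z) UNIV"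
      using F[of "?h $ 1" "?h $ 2"] small unfolding h by simp
    from M[OF small this]
    have "norm (f z - f p - (?c 1 0 * ?h $ 1 + ?c 0 1 * ?h $ 2)) \<le> M * (norm ?h)\<^sup>2"
      using has_power_series_center[OF assms] by (simp add: algebra_simps)
    then show "norm (f z - f p - (?c 1 0 * ?h $ 1 + ?c 0 1 * ?h $ 2)) / norm ?h \<le> M * norm ?h"
      using z by (simp add: divide_le_eq power2_eq_square mult.assoc)
  qed
qed

text \<open>
  The one-dimensional derivative along a coordinate axis. Unlike the Frechet derivative it can be
  computed in a whole neighbourhood of \<open>p\<close> from the series at \<open>p\<close> alone, by differentiating on lines.
\<close>

definition directional :: "2 \<Rightarrow> (real^2 \<Rightarrow> real) \<Rightarrow> real^2 \<Rightarrow> real" where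
  "directional k f z = deriv (\<lambda>t. f (z + t *\<^sub>R axis k 1)) 0"

lemma has_power_series_directional_1:
  assumes "has_power_series f p F"
  shows "has_power_series (directional 1 f) p (fps_deriv F)"
proof -
  obtain r where r: "r > 0" and F: "\<And>x y. \<bar>x\<bar> < r \<Longrightarrow> \<bar>y\<bar> < r \<Longrightarrow>
      ((\<lambda>(i, j). coeff2 F i j * x ^ i * y ^ j) has_sum f (p + vector [x, y])) UNIV"
    using has_power_series_square[OF assms] by blast
  show ?thesis
  proof (rule has_power_seriesI_square[OF r])
    fix x y :: real
    assume x: "\<bar>x\<bar> < r" and y: "\<bar>y\<bar> < r"
    obtain D where D: "((\<lambda>t. f (p + vector [t, y])) has_real_derivative D) (at x)"
      and sum: "((\<lambda>(i, j). real (Suc i) * coeff2 F (Suc i) j * x ^ i * y ^ j) has_sum D) UNIV"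
      using double_series_partial[OF F x y] by blast
    have "vector [x, y] + t *\<^sub>R axis 1 1 = (vector [t + x, y] :: real^2)" for t
      by (simp add: vec_eq_iff forall_2 axis_def)
    moreover have "((\<lambda>t. f (p + vector [t + x, y])) has_real_derivative D) (at 0)"
      using D DERIV_shift[of "\<lambda>t. f (p + vector [t, y])" D 0 x] by simp
    ultimately have "directional 1 f (p + vector [x, y]) = D"
      unfolding directional_def by (simp add: add.assoc DERIV_imp_deriv)
    moreover have "coeff2 (fps_deriv F) i j = real (Suc i) * coeff2 F (Suc i) j" for i j
      by (simp add: fps_of_nat[symmetric] del: of_nat_Suc)
    ultimately show "((\<lambda>(i, j). coeff2 (fps_deriv F) i j * x ^ i * y ^ j) has_sum
        directional 1 f (p + vector [x, y])) UNIV"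
      using sum by simp
  qed
qed

lemma has_power_series_directional_2:
  assumes "has_power_series f p F"
  shows "has_power_series (directional 2 f) p (Abs_fps (\<lambda>i. fps_deriv (fps_nth F i)))"
proof -
  obtain r where r: "r > 0" and F: "\<And>x y. \<bar>x\<bar> < r \<Longrightarrow> \<bar>y\<bar> < r \<Longrightarrow>
      ((\<lambda>(i, j). coeff2 F i j * x ^ i * y ^ j) has_sum f (p + vector [x, y])) UNIV"
    using has_power_series_square[OF assms] by blast
  have swap: "((\<lambda>(j, i). coeff2 F i j * y ^ j * x ^ i) has_sum f (p + vector [x, y])) UNIV"
    if "\<bar>y\<bar> < r" "\<bar>x\<bar> < r" for x y
    using F[OF that(2,1)] has_sum_swap[where f = "\<lambda>(i, j). coeff2 F i j * x ^ i * y ^ j" and A = UNIV and B = UNIV]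
    by (simp add: mult_ac)
  show ?thesis
  proof (rule has_power_seriesI_square[OF r])
    fix x y :: real
    assume x: "\<bar>x\<bar> < r" and y: "\<bar>y\<bar> < r"
    obtain D where D: "((\<lambda>t. f (p + vector [x, t])) has_real_derivative D) (at y)"
      and sum: "((\<lambda>(j, i). real (Suc j) * coeff2 F i (Suc j) * y ^ j * x ^ i) has_sum D) UNIV"
      using double_series_partial[where g = "\<lambda>y x. f (p + vector [x, y])"
          and c = "\<lambda>j i. coeff2 F i j", OF swap y x] by blast
    have "vector [x, y] + t *\<^sub>R axis 2 1 = (vector [x, t + y] :: real^2)" for t
      by (simp add: vec_eq_iff forall_2 axis_def)
    moreover have "((\<lambda>t. f (p + vector [x, t + y])) has_real_derivative D) (at 0)"
      using D DERIV_shift[of "\<lambda>t. f (p + vector [x, t])" D 0 y] by simp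
    ultimately have "directional 2 f (p + vector [x, y]) = D"
      unfolding directional_def by (simp add: add.assoc DERIV_imp_deriv)
    then show "((\<lambda>(i, j). coeff2 (Abs_fps (\<lambda>i. fps_deriv (fps_nth F i))) i j * x ^ i * y ^ j)
        has_sum directional 2 f (p + vector [x, y])) UNIV"
      using sum has_sum_swap[where f = "\<lambda>(j, i). real (Suc j) * coeff2 F i (Suc j) * y ^ j * x ^ i"
          and A = UNIV and B = UNIV]
      by (simp add: mult_ac)
  qed
qed

text \<open>
  The constant coefficient is the value at the centre, and every other coefficient is a positive
  multiple of a lower one of the series of a directional derivative; so induction on the degree
  recovers all coefficients from the function.
\<close>

lemma has_power_series_unique:
  assumes "has_power_series f p F" and "has_power_series f p F'"
  shows "F = F'"
proof -
  have "coeff2 F i j = coeff2 F' i j" for i j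
    using assms
  proof (induction "i + j" arbitrary: i j f F F' rule: less_induct)
    case less
    consider "i = 0" "j = 0" | k where "i = Suc k" | k where "i = 0" "j = Suc k"
      by (cases i; cases j) auto
    then show ?case
    proof cases
      case 1
      then show ?thesis
        using less.prems has_power_series_center by metis
    next
      case 2
      have "coeff2 (fps_deriv F) k j = coeff2 (fps_deriv F') k j"
        using less.prems[THEN has_power_series_directional_1] by (intro less.hyps[of k j]) (auto simp: 2)
      then show ?thesis
        by (simp add: 2 fps_of_nat[symmetric] del: of_nat_Suc)
    next
      case 3
      have "coeff2 (Abs_fps (\<lambda>i. fps_deriv (fps_nth F i))) 0 k
          = coeff2 (Abs_fps (\<lambda>i. fps_deriv (fps_nth F' i))) 0 k"
        using less.prems[THEN has_power_series_directional_2] by (intro less.hyps[of 0 k]) (auto simp: 3)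
      then show ?thesis
        by (simp add: 3 del: of_nat_Suc)
    qed
  qed
  then show ?thesis
    by (simp add: fps_eq_iff)
qed

section \<open>Partial derivatives of analytic functions\<close>

definition partial :: "2 \<Rightarrow> (real^2 \<Rightarrow> real) \<Rightarrow> real^2 \<Rightarrow> real" where
  "partial k f z = frechet_derivative f (at z) (axis k 1)"

lemma real_analytic_on_differentiable:
  assumes "real_analytic_on f S" "z \<in> S"
  shows "f differentiable (at z)"
  using assms has_power_series_has_derivative unfolding real_analytic_on_def differentiable_def by blast

lemma directional_eq_partial:
  assumes "f differentiable (at z)"
  shows "directional k f z = partial k f z"
proof -
  have f: "(f has_derivative frechet_derivative f (at z)) (at z)"
    using assms frechet_derivative_works by blast
  have "((\<lambda>t. z + t *\<^sub>R axis k 1) has_derivative (\<lambda>t. t *\<^sub>R axis k 1)) (at 0)"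
    by (auto intro!: derivative_eq_intros)
  with f have "((\<lambda>t. f (z + t *\<^sub>R axis k 1)) has_derivative
      (\<lambda>t. frechet_derivative f (at z) (t *\<^sub>R axis k 1))) (at 0)"
    using has_derivative_compose[of "\<lambda>t. z + t *\<^sub>R axis k 1" _ 0 UNIV f] by simp
  moreover have "frechet_derivative f (at z) (t *\<^sub>R axis k 1) = partial k f z * t" for t
    using linear_frechet_derivative[OF assms] by (simp add: partial_def linear_scale)
  ultimately show ?thesis
    unfolding directional_def by (intro DERIV_imp_deriv) (simp add: has_field_derivative_def)
qed

lemma has_power_series_cong:
  assumes "has_power_series f p F" "open S" "p \<in> S" "\<And>z. z \<in> S \<Longrightarrow> f z = g z"
  shows "has_power_series g p F"
proof -
  have "\<forall>\<^sub>F h in nhds 0. p + h \<in> S"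
  proof -
    have "filterlim (\<lambda>h. p + h) (nhds p) (nhds 0)"
      by (rule tendsto_eq_intros filterlim_ident refl | simp)+
    then show ?thesis
      using eventually_nhds_in_open[OF assms(2,3)] by (auto simp: filterlim_iff)
  qed
  then show ?thesis
    using assms(1) unfolding has_power_series_def by eventually_elim (simp add: assms(4))
qed

lemma has_power_series_partial:
  assumes "real_analytic_on f S" "open S" "p \<in> S" "has_power_series f p F"
  shows "has_power_series (partial 1 f) p (fps_deriv F)"
    and "has_power_series (partial 2 f) p (Abs_fps (\<lambda>i. fps_deriv (fps_nth F i)))"
  using has_power_series_cong[OF _ assms(2,3)] directional_eq_partial
    real_analytic_on_differentiable[OF assms(1)]
    has_power_series_directional_1[OF assms(4)] has_power_series_directional_2[OF assms(4)]
  by blast+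

lemma real_analytic_on_partial:
  assumes "real_analytic_on f S" "open S"
  shows "real_analytic_on (partial k f) S"
  using assms has_power_series_partial[OF assms] exhaust_2[of k] unfolding real_analytic_on_def by metis

lemma frechet_derivative_partial:
  assumes "f differentiable (at z)"
  shows "frechet_derivative f (at z) v = v $ 1 * partial 1 f z + v $ 2 * partial 2 f z"
proof -
  have "v = v $ 1 *\<^sub>R axis 1 1 + v $ 2 *\<^sub>R axis 2 1"
    by (simp add: vec_eq_iff forall_2 axis_def)
  then have "frechet_derivative f (at z) v
      = frechet_derivative f (at z) (v $ 1 *\<^sub>R axis 1 1 + v $ 2 *\<^sub>R axis 2 1)"
    by (rule arg_cong)
  also have "\<dots> = v $ 1 * partial 1 f z + v $ 2 * partial 2 f z"
    by (simp only: linear_add[OF linear_frechet_derivative[OF assms]]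
        linear_scale[OF linear_frechet_derivative[OF assms]] partial_def real_scaleR_def)
  finally show ?thesis .
qed

lemma power_series_coeff:
  assumes "real_analytic_on f S" "open S" "p \<in> S" "has_power_series f p F"
  shows "coeff2 F 0 0 = f p"
    and "coeff2 F 1 0 = partial 1 f p"
    and "coeff2 F 0 1 = partial 2 f p"
    and "coeff2 F 1 1 = partial 1 (partial 2 f) p"
    and "coeff2 F 1 1 = partial 2 (partial 1 f) p"
    and "2 * coeff2 F 2 0 = partial 1 (partial 1 f) p"
proof -
  note S = assms(2,3)
  note d = has_power_series_partial[OF assms]
  note d1 = has_power_series_partial[OF real_analytic_on_partial[OF assms(1,2)] S d(1)]
  note d2 = has_power_series_partial[OF real_analytic_on_partial[OF assms(1,2)] S d(2)]
  show "coeff2 F 0 0 = f p"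
    using has_power_series_center[OF assms(4)] .
  show "coeff2 F 1 0 = partial 1 f p" "coeff2 F 0 1 = partial 2 f p"
    using d[THEN has_power_series_center] by simp_all
  show "coeff2 F 1 1 = partial 1 (partial 2 f) p"
    using d2(1)[THEN has_power_series_center] by simp
  show "coeff2 F 1 1 = partial 2 (partial 1 f) p"
    using d1(2)[THEN has_power_series_center] by simp
  show "2 * coeff2 F 2 0 = partial 1 (partial 1 f) p"
    using d1(1)[THEN has_power_series_center] by (simp add: numeral_2_eq_2 numeral_fps_const)
qed

text \<open>
  Symmetry of second derivatives: both sides are the coefficient of \<open>x y\<close>.
\<close>

lemma partial_commute:
  assumes "real_analytic_on f S" "open S" "p \<in> S"
  shows "partial 1 (partial 2 f) p = partial 2 (partial 1 f) p"
  using assms power_series_coeff(4,5)[OF assms] unfolding real_analytic_on_def by metis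

lemma frechet_derivative_mult:
  fixes f g :: "real^2 \<Rightarrow> real"
  assumes "f differentiable (at z)" "g differentiable (at z)"
  shows "frechet_derivative (\<lambda>z. f z * g z) (at z) v
    = f z * frechet_derivative g (at z) v + frechet_derivative f (at z) v * g z"
  using has_derivative_mult[OF assms[unfolded frechet_derivative_works]]
  by (simp flip: frechet_derivative_at)

lemma frechet_derivative_diff:
  fixes f g :: "real^2 \<Rightarrow> real"
  assumes "f differentiable (at z)" "g differentiable (at z)"
  shows "frechet_derivative (\<lambda>z. f z - g z) (at z) v
    = frechet_derivative f (at z) v - frechet_derivative g (at z) v"
  using has_derivative_diff[OF assms[unfolded frechet_derivative_works]]
  by (simp flip: frechet_derivative_at)

lemma partial_cong:
  assumes "f differentiable (at z)" "open S" "z \<in> S" "\<forall>w\<in>S. f w = g w"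
  shows "partial k f z = partial k g z"
  using frechet_derivative_transform_within_open[OF assms(1-3), of g] assms(4) by (simp add: partial_def)

section \<open>Jacobians\<close>

lemma frechet_derivative_component:
  fixes X :: "real^2 \<Rightarrow> real^2"
  assumes "analytic_vector_field_on X S" "z \<in> S"
  shows "frechet_derivative X (at z) v $ k = frechet_derivative (\<lambda>z. X z $ k) (at z) v"
proof -
  let ?D = "\<lambda>v. \<chi> k. frechet_derivative (\<lambda>z. X z $ k) (at z) v"
  have "((\<lambda>z. X z $ k) has_derivative frechet_derivative (\<lambda>z. X z $ k) (at z)) (at z)" for k
    using assms real_analytic_on_differentiable frechet_derivative_works
    unfolding analytic_vector_field_on_def by blast
  then have "(X has_derivative ?D) (at z)"
    unfolding has_derivative_componentwise_within[of X]
    by (auto simp: Basis_vec_def inner_axis)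
  then show ?thesis
    by (simp flip: frechet_derivative_at)
qed

lemma jacobian_entry:
  assumes "analytic_vector_field_on X S" "z \<in> S"
  shows "jacobian X (at z) $ i $ j = partial j (\<lambda>z. X z $ i) z"
  using frechet_derivative_component[OF assms] by (simp add: jacobian_def matrix_def partial_def)

section \<open>The ring of convergent power series\<close>

lemma coeff2_mult:
  fixes F G :: "'a::comm_ring_1 fps fps"
  shows "coeff2 (F * G) i j = (\<Sum>(a, b)\<in>{..i} \<times> {..j}. coeff2 F a b * coeff2 G (i - a) (j - b))"
  by (simp add: fps_mult_nth fps_sum_nth sum.cartesian_product atLeast0AtMost)

text \<open>
  The product family \<open>u p * v q\<close> is summable, and grouping its terms by the sum of the two exponent
  pairs is a reindexing.
\<close>

lemma summable_on_double_Cauchy_product: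
  fixes u v :: "nat \<times> nat \<Rightarrow> real"
  assumes u: "u summable_on UNIV" "\<And>p. 0 \<le> u p" and v: "v summable_on UNIV" "\<And>p. 0 \<le> v p"
  shows "(\<lambda>(i, j). \<Sum>(a, b)\<in>{..i} \<times> {..j}. u (a, b) * v (i - a, j - b)) summable_on UNIV"
proof -
  have "(\<lambda>(p, q). u p * v q) summable_on UNIV \<times> UNIV"
  proof (rule summable_on_SigmaI)
    show "((\<lambda>q. case (p, q) of (p, q) \<Rightarrow> u p * v q) has_sum u p * infsum v UNIV) UNIV" for p
      using has_sum_cmult_right[OF has_sum_infsum[OF v(1)], of "u p"] by simp
    show "(\<lambda>p. u p * infsum v UNIV) summable_on UNIV"
      by (rule summable_on_cmult_left[OF u(1)])
  qed (use u v in auto)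
  moreover have bij: "bij_betw (\<lambda>((i, j), (a, b)). ((a, b), (i - a, j - b)))
      (SIGMA (i, j):UNIV. {..i} \<times> {..j}) (UNIV \<times> UNIV :: ((nat \<times> nat) \<times> (nat \<times> nat)) set)"
    by (rule bij_betwI[where g = "\<lambda>((a, b), (c, d)). ((a + c, b + d), (a, b))"]) auto
  ultimately have "(\<lambda>x. (\<lambda>(p, q). u p * v q) ((\<lambda>((i, j), (a, b)). ((a, b), (i - a, j - b))) x))
      summable_on (SIGMA (i, j):UNIV. {..i} \<times> {..j})"
    using summable_on_reindex_bij_betw[OF bij, of "\<lambda>(p, q). u p * v q"] by blast
  then have "(\<lambda>((i, j), (a, b)). u (a, b) * v (i - a, j - b)) summable_on (SIGMA (i, j):UNIV. {..i} \<times> {..j})"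
    by (simp add: case_prod_unfold)
  from summable_on_Sigma_banach[of "\<lambda>(i, j) (a, b). u (a, b) * v (i - a, j - b)",
      simplified case_prod_unfold, OF this[simplified case_prod_unfold]]
  show ?thesis
    by (simp add: case_prod_unfold)
qed

lemma convergent_series_common_radius:
  assumes "F \<in> convergent_series" "G \<in> convergent_series"
  obtains r where "r > 0" "(\<lambda>(i, j). norm (coeff2 F i j) * r ^ (i + j)) summable_on UNIV"
    "(\<lambda>(i, j). norm (coeff2 G i j) * r ^ (i + j)) summable_on UNIV"
proof -
  have shrink: "(\<lambda>(i, j). norm (coeff2 H i j) * r ^ (i + j)) summable_on UNIV"
    if "(\<lambda>(i, j). norm (coeff2 H i j) * s ^ (i + j)) summable_on UNIV" "0 < r" "r \<le> s" for H :: "complex fps fps" and r s :: real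
    by (rule summable_on_comparison_test[OF that(1)])
      (use that in \<open>auto intro!: mult_left_mono power_mono\<close>)
  obtain r s where "r > 0" "(\<lambda>(i, j). norm (coeff2 F i j) * r ^ (i + j)) summable_on UNIV"
    "s > 0" "(\<lambda>(i, j). norm (coeff2 G i j) * s ^ (i + j)) summable_on UNIV"
    using assms unfolding convergent_series_def by blast
  then show thesis
    using that[of "min r s"] shrink[of F r "min r s"] shrink[of G s "min r s"] by auto
qed

lemma convergent_series_add:
  assumes "F \<in> convergent_series" "G \<in> convergent_series"
  shows "F + G \<in> convergent_series"
proof -
  obtain r where r: "r > 0" and F: "(\<lambda>(i, j). norm (coeff2 F i j) * r ^ (i + j)) summable_on UNIV"
    and G: "(\<lambda>(i, j). norm (coeff2 G i j) * r ^ (i + j)) summable_on UNIV"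
    using convergent_series_common_radius[OF assms] by blast
  have "(\<lambda>(i, j). norm (coeff2 (F + G) i j) * r ^ (i + j)) summable_on UNIV"
    by (rule summable_on_comparison_test[OF summable_on_add[OF F G]])
      (use r in \<open>auto simp: norm_triangle_ineq simp flip: distrib_right intro!: mult_right_mono\<close>)
  with r show ?thesis
    unfolding convergent_series_def by blast
qed

lemma convergent_series_mult:
  assumes "F \<in> convergent_series" "G \<in> convergent_series"
  shows "F * G \<in> convergent_series"
proof -
  obtain r where r: "r > 0" and F: "(\<lambda>(i, j). norm (coeff2 F i j) * r ^ (i + j)) summable_on UNIV"
    and G: "(\<lambda>(i, j). norm (coeff2 G i j) * r ^ (i + j)) summable_on UNIV"
    using convergent_series_common_radius[OF assms] by blast
  define w where "w H = (\<lambda>(i, j). norm (coeff2 H i j) * r ^ (i + j))" for H :: "complex fps fps"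
  have "w (F * G) summable_on UNIV"
  proof (rule summable_on_comparison_test)
    show "(\<lambda>(i, j). \<Sum>(a, b)\<in>{..i} \<times> {..j}. w F (a, b) * w G (i - a, j - b)) summable_on UNIV"
      by (rule summable_on_double_Cauchy_product) (use F G r in \<open>auto simp: w_def\<close>)
    fix p :: "nat \<times> nat"
    obtain i j where p: "p = (i, j)"
      by (cases p)
    have "w (F * G) p \<le> (\<Sum>(a, b)\<in>{..i} \<times> {..j}. norm (coeff2 F a b * coeff2 G (i - a) (j - b))) * r ^ (i + j)"
      unfolding p w_def coeff2_mult prod.case
      using r by (intro mult_right_mono order_trans[OF norm_sum] sum_mono) auto
    also have "\<dots> = (\<Sum>(a, b)\<in>{..i} \<times> {..j}. w F (a, b) * w G (i - a, j - b))"
      unfolding sum_distrib_right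
    proof (intro sum.cong refl)
      fix q assume "q \<in> {..i} \<times> {..j}"
      then obtain a b where q: "q = (a, b)" "a \<le> i" "b \<le> j"
        by auto
      then have "i + j = (a + b) + ((i - a) + (j - b))"
        by simp
      then have "r ^ (i + j) = r ^ (a + b) * r ^ ((i - a) + (j - b))"
        by (metis power_add)
      then show "(case q of (a, b) \<Rightarrow> norm (coeff2 F a b * coeff2 G (i - a) (j - b))) * r ^ (i + j)
          = (case q of (a, b) \<Rightarrow> w F (a, b) * w G (i - a, j - b))"
        by (simp only: q prod.case w_def norm_mult mult_ac)
    qed
    finally show "w (F * G) p \<le> (case p of (i, j) \<Rightarrow> \<Sum>(a, b)\<in>{..i} \<times> {..j}. w F (a, b) * w G (i - a, j - b))"
      by (simp add: p)
    show "0 \<le> w (F * G) p"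
      using r by (simp add: p w_def)
  qed
  with r show ?thesis
    unfolding convergent_series_def w_def by blast
qed

lemma convergent_series_finite:
  assumes "finite {(i, j). coeff2 F i j \<noteq> 0}"
  shows "F \<in> convergent_series"
proof -
  have "(\<lambda>(i, j). norm (coeff2 F i j) * 1 ^ (i + j)) summable_on {(i, j). coeff2 F i j \<noteq> 0}"
    using assms by (rule summable_on_finite)
  then have "(\<lambda>(i, j). norm (coeff2 F i j) * 1 ^ (i + j)) summable_on UNIV"
    by (rule summable_on_cong_neutral[THEN iffD1, rotated -1]) auto
  then show ?thesis
    unfolding convergent_series_def by (intro CollectI exI[of _ 1]) simp
qed

abbreviation const_series :: "complex \<Rightarrow> complex fps fps" where
  "const_series c \<equiv> fps_const (fps_const c)"

lemma const_convergent: "const_series c \<in> convergent_series"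
  by (rule convergent_series_finite, rule finite_subset[of _ "{(0, 0)}"]) (auto split: if_splits)

lemma fps_X_convergent: "fps_X \<in> (convergent_series :: complex fps fps set)"
  by (rule convergent_series_finite, rule finite_subset[of _ "{(1, 0)}"]) (auto split: if_splits)

lemma convergent_series_uminus: "- F \<in> convergent_series" if "F \<in> convergent_series"
  using that unfolding convergent_series_def by simp

lemma convergent_ring_simps [simp]:
  "carrier convergent_ring = convergent_series" "F \<otimes>\<^bsub>convergent_ring\<^esub> G = F * G"
  "F \<oplus>\<^bsub>convergent_ring\<^esub> G = F + G" "\<one>\<^bsub>convergent_ring\<^esub> = 1" "\<zero>\<^bsub>convergent_ring\<^esub> = 0"
  by (simp_all add: convergent_ring_def)

lemma one_zero_convergent: "1 \<in> convergent_series" "0 \<in> convergent_series"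
  using const_convergent[of 1] const_convergent[of 0] by simp_all

lemma cring_convergent_ring: "cring convergent_ring"
proof (rule cringI)
  show "abelian_group convergent_ring"
    by (rule abelian_groupI)
      (auto simp: convergent_series_add one_zero_convergent add_ac
        intro!: bexI[OF _ convergent_series_uminus])
  show "comm_monoid convergent_ring"
    by (rule comm_monoidI) (auto simp: convergent_series_mult one_zero_convergent mult_ac)
qed (simp add: algebra_simps)

lemma a_inv_convergent_ring:
  assumes "F \<in> convergent_series"
  shows "\<ominus>\<^bsub>convergent_ring\<^esub> F = - F"
proof -
  interpret cring convergent_ring
    by (rule cring_convergent_ring)
  show ?thesis
    using minus_equality[of "- F" F] assms convergent_series_uminus by simp
qed

lemma subfield_constants: "subfield (range const_series) convergent_ring"
proof -
  interpret cring convergent_ring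
    by (rule cring_convergent_ring)
  show ?thesis
  proof (rule subfieldI)
    show "subcring (range const_series) convergent_ring"
    proof (rule subcringI', rule subringI)
      show "\<ominus>\<^bsub>convergent_ring\<^esub> h \<in> range const_series" if "h \<in> range const_series" for h
        using that by (auto simp: a_inv_convergent_ring const_convergent)
      show "\<one>\<^bsub>convergent_ring\<^esub> \<in> range const_series"
        by (auto intro!: image_eqI[of _ _ 1])
    qed (auto simp: const_convergent)
    have unit: "const_series c \<in> Units (convergent_ring\<lparr>carrier := range const_series\<rparr>)" if "c \<noteq> 0" for c
      using that by (auto simp: Units_def intro!: exI[of _ "inverse c"])
    have "c \<noteq> 0" if "const_series c \<in> Units (convergent_ring\<lparr>carrier := range const_series\<rparr>)" for c
      using that by (auto simp: Units_def)
    with unit show "Units (convergent_ring\<lparr>carrier := range const_series\<rparr>) = range const_series - {\<zero>\<^bsub>convergent_ring\<^esub>}"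
      by (auto simp: Units_def)
  qed
qed

section \<open>A lower bound for the multiplicity\<close>

text \<open>
  Restricting \<open>F\<close> to the parabola \<open>y = l x\<^sup>2\<close> gives, modulo \<open>x\<^sup>3\<close>, the polynomial
  \<open>F\<^sub>0\<^sub>0 + F\<^sub>1\<^sub>0 x + (F\<^sub>2\<^sub>0 + l F\<^sub>0\<^sub>1) x\<^sup>2\<close>. The following set is the kernel of this restriction, a ring
  homomorphism onto \<open>\<complex>[x] / (x\<^sup>3)\<close>.
\<close>

definition parabola_ideal :: "complex \<Rightarrow> complex fps fps set" where
  "parabola_ideal l = {F \<in> convergent_series.
     coeff2 F 0 0 = 0 \<and> coeff2 F 1 0 = 0 \<and> coeff2 F 2 0 + l * coeff2 F 0 1 = 0}"

lemma ideal_parabola_ideal: "ideal (parabola_ideal l) convergent_ring"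
proof -
  interpret cring convergent_ring
    by (rule cring_convergent_ring)
  have mult: "F * G \<in> parabola_ideal l" if "F \<in> parabola_ideal l" "G \<in> convergent_series" for F G
  proof -
    have "coeff2 (F * G) 2 0 + l * coeff2 (F * G) 0 1
        = (coeff2 F 2 0 + l * coeff2 F 0 1) * coeff2 G 0 0 + coeff2 F 1 0 * coeff2 G 1 0
          + coeff2 F 0 0 * (coeff2 G 2 0 + l * coeff2 G 0 1)"
      by (simp add: fps_mult_nth numeral_2_eq_2 algebra_simps)
    then show ?thesis
      using that by (simp add: parabola_ideal_def convergent_series_mult fps_mult_nth)
  qed
  show ?thesis
  proof (rule idealI)
    show "subgroup (parabola_ideal l) (add_monoid convergent_ring)"
    proof (rule add.subgroupI)
      show "parabola_ideal l \<noteq> {}"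
        using one_zero_convergent by (auto simp: parabola_ideal_def intro!: exI[of _ 0])
      show "\<ominus>\<^bsub>convergent_ring\<^esub> F \<in> parabola_ideal l" if "F \<in> parabola_ideal l" for F
      proof -
        have "l * coeff2 F 0 1 = - coeff2 F 2 0"
          using that by (simp add: parabola_ideal_def add_eq_0_iff)
        then show ?thesis
          using that by (simp add: parabola_ideal_def a_inv_convergent_ring convergent_series_uminus)
      qed
      show "F \<oplus>\<^bsub>convergent_ring\<^esub> G \<in> parabola_ideal l" if "F \<in> parabola_ideal l" "G \<in> parabola_ideal l" for F G
      proof -
        have "l * coeff2 F 0 1 = - coeff2 F 2 0" "l * coeff2 G 0 1 = - coeff2 G 2 0"
          using that by (simp_all add: parabola_ideal_def add_eq_0_iff)
        then show ?thesis
          using that by (simp add: parabola_ideal_def convergent_series_add distrib_left)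
      qed
    qed (auto simp: parabola_ideal_def)
    show "x \<otimes>\<^bsub>convergent_ring\<^esub> a \<in> parabola_ideal l" "a \<otimes>\<^bsub>convergent_ring\<^esub> x \<in> parabola_ideal l"
      if "a \<in> parabola_ideal l" "x \<in> carrier convergent_ring" for a x
      using mult[of a x] that by (simp_all add: mult.commute)
  qed (rule ring_axioms)
qed

text \<open>
  The restriction to the parabola factors through the quotient by \<open>J\<close>, and it maps \<open>1\<close>, \<open>x\<close>, \<open>x\<^sup>2\<close> to a
  basis of \<open>\<complex>[x] / (x\<^sup>3)\<close>, so their classes modulo \<open>J\<close> are independent. Uniqueness of the dimension is
  recorded as well because the multiplicity selects it by a definite description; both facts rest on
  the constants still forming a field in the quotient, i.e. on \<open>J\<close> being proper.
\<close>

lemma dimension_quotient_ge_3: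
  assumes J: "ideal J convergent_ring" and JP: "J \<subseteq> parabola_ideal l"
  defines "K \<equiv> range (\<lambda>c. J +>\<^bsub>convergent_ring\<^esub> const_series c)"
  assumes n: "ring.dimension (convergent_ring Quot J) n K (carrier (convergent_ring Quot J))"
  shows "3 \<le> n"
    and "ring.dimension (convergent_ring Quot J) m K (carrier (convergent_ring Quot J)) \<Longrightarrow> m = n"
proof -
  let ?A = "convergent_ring Quot J" and ?\<pi> = "\<lambda>F. J +>\<^bsub>convergent_ring\<^esub> F"
  interpret C: cring convergent_ring
    by (rule cring_convergent_ring)
  interpret J: ideal J convergent_ring
    by (rule J)
  interpret \<pi>: ring_hom_ring convergent_ring ?A ?\<pi>
    by (rule J.rcos_ring_hom_ring)
  have zero: "?\<pi> F = \<zero>\<^bsub>?A\<^esub> \<longleftrightarrow> F \<in> J" if "F \<in> convergent_series" for F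
    using that J.rcos_const_imp_mem C.a_rcos_zero[OF J] by (auto simp: FactRing_def)
  have "1 \<notin> J"
    using JP by (auto simp: parabola_ideal_def)
  then have one: "\<one>\<^bsub>?A\<^esub> \<noteq> \<zero>\<^bsub>?A\<^esub>"
    using zero[OF one_zero_convergent(1)] \<pi>.hom_one by simp
  have K: "subfield K ?A"
    using \<pi>.img_is_subfield(2)[OF subfield_constants one] by (simp add: K_def image_image)
  have X: "fps_X \<in> convergent_series" "fps_X ^ 2 \<in> (convergent_series :: complex fps fps set)"
    by (simp_all add: fps_X_convergent convergent_series_mult power2_eq_square)
  let ?Us = "[?\<pi> 1, ?\<pi> fps_X, ?\<pi> (fps_X ^ 2)]"
  have Us: "set ?Us \<subseteq> carrier ?A"
    using X one_zero_convergent \<pi>.hom_closed by simp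
  have trivial: "a = 0 \<and> b = 0 \<and> c = 0"
    if "?\<pi> (const_series a * 1 + (const_series b * fps_X + const_series c * fps_X ^ 2)) = \<zero>\<^bsub>?A\<^esub>" for a b c
  proof -
    let ?P = "const_series a * 1 + (const_series b * fps_X + const_series c * fps_X ^ 2)"
    have "?P \<in> convergent_series"
      by (intro convergent_series_add convergent_series_mult const_convergent X one_zero_convergent)
    then have "?P \<in> parabola_ideal l"
      using that zero JP by blast
    moreover have "coeff2 ?P 0 0 = a" "coeff2 ?P 1 0 = b" "coeff2 ?P 2 0 = c" "coeff2 ?P 0 1 = 0"
      by (simp_all add: fps_X_power_nth)
    ultimately show ?thesis
      by (simp add: parabola_ideal_def)
  qed
  have "\<pi>.S.independent K ?Us"
  proof (rule \<pi>.S.trivial_combine_imp_independent[OF K Us])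
    fix Ks assume Ks: "set Ks \<subseteq> K" and comb: "\<pi>.S.combine Ks ?Us = \<zero>\<^bsub>?A\<^esub>"
    have m: "?\<pi> F \<otimes>\<^bsub>?A\<^esub> ?\<pi> G = ?\<pi> (F * G)" and a: "?\<pi> F \<oplus>\<^bsub>?A\<^esub> ?\<pi> G = ?\<pi> (F + G)"
      if "F \<in> convergent_series" "G \<in> convergent_series" for F G
      using \<pi>.hom_mult[of F G] \<pi>.hom_add[of F G] that by simp_all
    have expand: "\<pi>.S.combine [?\<pi> (const_series a), ?\<pi> (const_series b), ?\<pi> (const_series c)] ?Us
        = ?\<pi> (const_series a * 1 + (const_series b * fps_X + const_series c * fps_X ^ 2))" for a b c
      using \<pi>.hom_closed
      by (simp add: m a X const_convergent one_zero_convergent convergent_series_mult convergent_series_add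
          del: mult_1_right)
    \<comment> \<open>A combination ignores surplus entries and reads missing ones as zero, so the coefficient
      list may be taken of length \<open>3\<close>.\<close>
    obtain Ks' where Ks': "set (take (length ?Us) Ks) \<subseteq> set Ks'" "set Ks' \<subseteq> set (take (length ?Us) Ks) \<union> {\<zero>\<^bsub>?A\<^esub>}"
        "length Ks' = length ?Us" "\<pi>.S.combine Ks' ?Us = \<zero>\<^bsub>?A\<^esub>"
      using \<pi>.S.combine_normalize[OF subset_trans[OF Ks subfieldE(3)[OF K]] Us comb] by blast
    have "set Ks' \<subseteq> K"
      using Ks'(2) Ks set_take_subset[of "length ?Us" Ks] subringE(2)[OF subfieldE(1)[OF K]] by blast
    moreover obtain k1 k2 k3 where k: "Ks' = [k1, k2, k3]"
      using Ks'(3) by (auto simp: length_Suc_conv)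
    ultimately obtain a b c where abc: "k1 = ?\<pi> (const_series a)" "k2 = ?\<pi> (const_series b)" "k3 = ?\<pi> (const_series c)"
      by (auto simp: K_def)
    have "a = 0 \<and> b = 0 \<and> c = 0"
      using Ks'(4) unfolding k abc expand by (rule trivial)
    moreover have "?\<pi> (const_series 0) = \<zero>\<^bsub>?A\<^esub>"
      using \<pi>.hom_zero by simp
    ultimately show "set (take (length ?Us) Ks) \<subseteq> {\<zero>\<^bsub>?A\<^esub>}"
      using Ks'(1) by (auto simp: k abc)
  qed
  from \<pi>.S.independent_length_le_dimension[OF K n this Us] show "3 \<le> n"
    by simp
  show "m = n" if "ring.dimension (convergent_ring Quot J) m K (carrier (convergent_ring Quot J))"
    using \<pi>.S.dimension_is_inj[OF K that n] .
qed

lemma complex_germ_coeff: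
  assumes "has_power_series f p F"
  shows "coeff2 (complex_germ f p) i j = complex_of_real (coeff2 F i j)"
proof -
  have "(THE F. has_power_series f p F) = F"
    using assms has_power_series_unique by blast
  then show ?thesis
    by (simp add: complex_germ_def)
qed

lemma complex_germ_convergent:
  assumes "has_power_series f p F"
  shows "complex_germ f p \<in> convergent_series"
proof -
  obtain r where "r > 0" "(\<lambda>(i, j). \<bar>coeff2 F i j\<bar> * r ^ (i + j)) summable_on UNIV"
    by (rule has_power_series_abs_summable[OF assms])
  then have "r > 0" "(\<lambda>(i, j). norm (coeff2 (complex_germ f p) i j) * r ^ (i + j)) summable_on UNIV"
    by (simp_all add: complex_germ_coeff[OF assms])
  then show ?thesis
    unfolding convergent_series_def by blast
qed

text \<open>
  If the first component has the form \<open>f = f\<^sub>2\<^sub>0 x\<^sup>2 + f\<^sub>0\<^sub>1 y + \<dots>\<close> with \<open>f\<^sub>0\<^sub>1 \<noteq> 0\<close>, its zero set osculates the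
  parabola \<open>y = l x\<^sup>2\<close> with \<open>l = - f\<^sub>2\<^sub>0 / f\<^sub>0\<^sub>1\<close>, so \<open>f\<close> restricts to \<open>O(x\<^sup>3)\<close> on it; so does the second
  component, as its terms in \<open>1\<close>, \<open>x\<close>, \<open>y\<close>, \<open>x\<^sup>2\<close> vanish. If the quotient is infinite-dimensional, the
  multiplicity is \<open>\<infinity>\<close> and the bound is trivial.
\<close>

lemma multiplicity_ge_3:
  assumes f: "has_power_series (\<lambda>z. X z $ 1) p F" and h: "has_power_series (\<lambda>z. X z $ 2) p H"
    and "coeff2 F 0 0 = 0" "coeff2 F 1 0 = 0" "coeff2 F 0 1 \<noteq> 0"
    and "coeff2 H 0 0 = 0" "coeff2 H 1 0 = 0" "coeff2 H 0 1 = 0" "coeff2 H 2 0 = 0"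
  shows "3 \<le> multiplicity_at X p"
proof -
  interpret C: cring convergent_ring
    by (rule cring_convergent_ring)
  let ?gens = "{complex_germ (\<lambda>z. X z $ 1) p, complex_germ (\<lambda>z. X z $ 2) p}"
  define l where "l = complex_of_real (- coeff2 F 2 0 / coeff2 F 0 1)"
  have carrier: "?gens \<subseteq> carrier convergent_ring"
    using complex_germ_convergent[OF f] complex_germ_convergent[OF h] by simp
  have ideal: "ideal (component_ideal X p) convergent_ring"
    unfolding component_ideal_def using carrier by (rule C.genideal_ideal)
  have "?gens \<subseteq> parabola_ideal l"
    using carrier assms(3-) by (auto simp: parabola_ideal_def complex_germ_coeff[OF f] complex_germ_coeff[OF h] l_def)
  then have sub: "component_ideal X p \<subseteq> parabola_ideal l"
    unfolding component_ideal_def by (rule C.genideal_minimal[OF ideal_parabola_ideal])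
  let ?has_dim = "\<lambda>n. ring.dimension (local_algebra X p) n (scalars X p) (carrier (local_algebra X p))"
  show ?thesis
  proof (cases "\<exists>n. ?has_dim n")
    case True
    then obtain n where n: "?has_dim n"
      by blast
    note dim = dimension_quotient_ge_3[OF ideal sub, folded local_algebra_def scalars_def, OF n]
    have "(THE n. ?has_dim n) = n"
      using n dim(2) by blast
    then show ?thesis
      using True dim(1) by (simp add: multiplicity_at_def Let_def numeral_eq_enat)
  next
    case False
    then show ?thesis
      by (simp add: multiplicity_at_def)
  qed
qed

section \<open>Equilibria off the axis\<close>

text \<open>
  A Hamiltonian field is divergence free, so \<open>div X = R\<^sub>x I\<^sub>y - R\<^sub>y I\<^sub>x\<close> for \<open>X = R (I\<^sub>y, - I\<^sub>x)\<close>. Since \<open>R p \<noteq> 0\<close>,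
  the point \<open>p\<close> is critical for \<open>I\<close>, and differentiating \<open>X\<close> there in a kernel direction \<open>q\<close> gives
  \<open>D\<^sub>q I\<^sub>y = D\<^sub>q I\<^sub>x = 0\<close>. So each summand of the divergence has a factor that vanishes at \<open>p\<close> together
  with its derivative in the direction \<open>q\<close>.
\<close>

lemma bt_b_conformally_hamiltonian:
  assumes S: "open S" "p \<in> S" and X: "analytic_vector_field_on X S"
    and I: "real_analytic_on I S" and R: "real_analytic_on R S" "R p \<noteq> 0"
    and XI: "\<And>z. z \<in> S \<Longrightarrow> X z = R z *\<^sub>R hamiltonian_field I z"
    and p: "X p = 0" and q: "frechet_derivative X (at p) q = 0"
  shows "bt_b X p q = 0"
proof -
  let ?I1 = "partial 1 I" and ?I2 = "partial 2 I"
  have I1: "real_analytic_on ?I1 S" and I2: "real_analytic_on ?I2 S"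
    and R1: "real_analytic_on (partial 1 R) S" and R2: "real_analytic_on (partial 2 R) S"
    using real_analytic_on_partial I R S by blast+
  note dI1 = real_analytic_on_differentiable[OF I1] and dI2 = real_analytic_on_differentiable[OF I2]
    and dR = real_analytic_on_differentiable[OF R(1)]
    and dR1 = real_analytic_on_differentiable[OF R1] and dR2 = real_analytic_on_differentiable[OF R2]
  have dX: "(\<lambda>z. X z $ k) differentiable (at z)" if "z \<in> S" for k z
    using X that real_analytic_on_differentiable unfolding analytic_vector_field_on_def by blast
  have dneg: "(\<lambda>w. - ?I1 w) differentiable (at z)" if "z \<in> S" for z
    using dI1[OF that] by (intro derivative_intros)
  have X1: "X z $ 1 = R z * ?I2 z" and X2: "X z $ 2 = R z * - ?I1 z" if "z \<in> S" for z
    using XI[OF that] by (simp_all add: hamiltonian_field_def partial_def)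
  have D1: "frechet_derivative (\<lambda>z. X z $ 1) (at z) v
      = R z * frechet_derivative ?I2 (at z) v + frechet_derivative R (at z) v * ?I2 z" if "z \<in> S" for z v
    using frechet_derivative_transform_within_open[OF dX[OF that] S(1) that X1]
    by (simp add: frechet_derivative_mult dR dI2 that)
  have D2: "frechet_derivative (\<lambda>z. X z $ 2) (at z) v
      = - (R z * frechet_derivative ?I1 (at z) v + frechet_derivative R (at z) v * ?I1 z)" if "z \<in> S" for z v
  proof -
    have "frechet_derivative (\<lambda>w. - ?I1 w) (at z) = (\<lambda>v. - frechet_derivative ?I1 (at z) v)"
      using dI1[OF that] by (intro frechet_derivative_at[symmetric] has_derivative_minus)
        (simp flip: frechet_derivative_works)
    moreover have "frechet_derivative (\<lambda>z. X z $ 2) (at z) v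
        = R z * frechet_derivative (\<lambda>w. - ?I1 w) (at z) v + frechet_derivative R (at z) v * - ?I1 z"
      using frechet_derivative_transform_within_open[OF dX[OF that] S(1) that X2]
        frechet_derivative_mult[OF dR dneg, OF that that] by simp
    ultimately show ?thesis
      by simp
  qed
  \<comment> \<open>The terms \<open>R * I\<^sub>x\<^sub>y\<close> cancel by symmetry of second derivatives.\<close>
  have trace: "trace (jacobian X (at z)) = partial 1 R z * ?I2 z - partial 2 R z * ?I1 z" if "z \<in> S" for z
    using D1[OF that, of "axis 1 1"] D2[OF that, of "axis 2 1"] partial_commute[OF I S(1) that]
    by (simp add: trace_def sum_2 jacobian_entry[OF X that] partial_def)
  have zero: "?I1 p = 0" "?I2 p = 0"
    using X1[OF S(2)] X2[OF S(2)] p R(2) by auto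
  have "frechet_derivative (\<lambda>z. X z $ k) (at p) q = 0" for k
    using frechet_derivative_component[OF X S(2), of q k] q by simp
  then have Dzero: "frechet_derivative ?I1 (at p) q = 0" "frechet_derivative ?I2 (at p) q = 0"
    using D1[OF S(2), of q] D2[OF S(2), of q] R(2) zero by auto
  have "bt_b X p q = frechet_derivative (\<lambda>z. partial 1 R z * ?I2 z - partial 2 R z * ?I1 z) (at p) q"
    unfolding bt_b_def
    by (subst frechet_derivative_transform_within_open[OF _ S, of "\<lambda>z. partial 1 R z * ?I2 z - partial 2 R z * ?I1 z"
          "\<lambda>z. trace (jacobian X (at z))", symmetric])
      (auto simp: trace intro!: derivative_intros dR1 dR2 dI1 dI2 S)
  also have "\<dots> = 0"
    by (subst frechet_derivative_diff)
      (auto simp: frechet_derivative_mult dR1 dR2 dI1 dI2 S zero Dzero intro!: derivative_intros)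
  finally show ?thesis .
qed

section \<open>Equilibria on the axis\<close>

text \<open>
  For a linear form \<open>\<phi> \<noteq> 0\<close> the hypothesis makes \<open>c\<close> an eigenvalue of the transpose of \<open>L\<close>, and the
  conclusion then shows \<open>c = 0\<close> whenever \<open>L\<close> is nilpotent.
\<close>

lemma funpow_eigenfunctional:
  fixes L :: "'a::real_vector \<Rightarrow> 'a"
  assumes "\<And>v. \<phi> (L v) = c * \<phi> v"
  shows "\<phi> ((L ^^ k) v) = (c :: real) ^ k * \<phi> v"
  using assms by (induction k) simp_all

lemma second_coordinate:
  shows "(\<lambda>z :: real^2. z $ 2) differentiable (at p)"
    and "frechet_derivative (\<lambda>z :: real^2. z $ 2) (at p) v = v $ 2"
proof -
  show "(\<lambda>z :: real^2. z $ 2) differentiable (at p)"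
    using bounded_linear_vec_nth bounded_linear_imp_differentiable by blast
  show "frechet_derivative (\<lambda>z :: real^2. z $ 2) (at p) v = v $ 2"
    using frechet_derivative_at[OF bounded_linear_imp_has_derivative[OF bounded_linear_vec_nth]] by metis
qed

lemma invariant_axis_partials:
  assumes U: "open U" and X: "analytic_vector_field_on X U" and G: "real_analytic_on G U"
    and XG: "\<forall>z\<in>U. X z $ 2 = z $ 2 * G z" and z: "z \<in> U"
  shows "partial 1 (\<lambda>z. X z $ 2) z = z $ 2 * partial 1 G z"
    and "partial 2 (\<lambda>z. X z $ 2) z = G z + z $ 2 * partial 2 G z"
proof -
  note d = second_coordinate(1)[of z] and f = second_coordinate(2)[of z]
  have "(\<lambda>z. X z $ 2) differentiable (at z)"
    using X z real_analytic_on_differentiable unfolding analytic_vector_field_on_def by blast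
  note cong = partial_cong[OF this U z XG]
  show "partial 1 (\<lambda>z. X z $ 2) z = z $ 2 * partial 1 G z"
    "partial 2 (\<lambda>z. X z $ 2) z = G z + z $ 2 * partial 2 G z"
    unfolding cong
    using frechet_derivative_mult[OF d real_analytic_on_differentiable[OF G z]]
    by (simp_all add: partial_def f axis_def)
qed

text \<open>
  On the invariant axis the linear part is upper triangular with diagonal entries \<open>f\<^sub>x p\<close> and \<open>G p\<close>, where
  \<open>f\<close> is the first component; nilpotency annihilates the diagonal, and what is left is \<open>f\<^sub>y p\<close>.
\<close>

lemma invariant_axis_nilpotent:
  assumes U: "open U" and X: "analytic_vector_field_on X U" and G: "real_analytic_on G U"
    and XG: "\<forall>z\<in>U. X z $ 2 = z $ 2 * G z"
    and p: "p \<in> U" "p $ 2 = 0"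
    and nil: "nilpotent_map (frechet_derivative X (at p))" and nz: "frechet_derivative X (at p) \<noteq> (\<lambda>_. 0)"
  shows "partial 1 (\<lambda>z. X z $ 1) p = 0" and "G p = 0" and "partial 2 (\<lambda>z. X z $ 1) p \<noteq> 0"
proof -
  let ?L = "frechet_derivative X (at p)"
  let ?a = "partial 1 (\<lambda>z. X z $ 1) p" and ?b = "partial 2 (\<lambda>z. X z $ 1) p"
  have dX: "(\<lambda>z. X z $ k) differentiable (at p)" for k
    using X p real_analytic_on_differentiable unfolding analytic_vector_field_on_def by blast
  have L1: "?L v $ 1 = ?a * v $ 1 + ?b * v $ 2" and L2: "?L v $ 2 = G p * v $ 2" for v
    using invariant_axis_partials[OF U X G XG p(1)] p(2)
    by (simp_all add: frechet_derivative_component[OF X p(1)] frechet_derivative_partial[OF dX])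
  obtain k where k: "?L ^^ k = (\<lambda>_. 0)"
    using nil unfolding nilpotent_map_def by blast
  have "(G p) ^ k * axis 2 1 $ 2 = (0::real)"
    using funpow_eigenfunctional[of "\<lambda>v. v $ 2" ?L "G p" k "axis 2 1"] L2 k by simp
  then show G0: "G p = 0"
    by (simp add: axis_def)
  have "(?L ^^ n) (axis 1 1) = ?a ^ n *\<^sub>R axis 1 1" for n
  proof (induction n)
    case (Suc n)
    then show ?case
      by (simp add: vec_eq_iff forall_2 L1 L2 axis_def)
  qed simp
  then have "?a ^ k *\<^sub>R (axis 1 1 :: real^2) = 0"
    using k by metis
  then show a0: "?a = 0"
    by (simp add: vec_eq_iff forall_2 axis_def)
  show "?b \<noteq> 0"
  proof
    assume "?b = 0"
    then have "?L = (\<lambda>_. 0)"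
      using a0 G0 by (simp add: fun_eq_iff vec_eq_iff forall_2 L1 L2)
    with nz show False
      by contradiction
  qed
qed

text \<open>
  The determinant is \<open>f\<^sub>x (G + y G\<^sub>y) - y f\<^sub>y G\<^sub>x\<close>. In the first product both factors vanish at \<open>p\<close>; in the
  second, \<open>y\<close> vanishes along the whole axis, hence in the direction \<open>q\<close>.
\<close>

lemma bt_a_invariant_axis:
  assumes U: "open U" and X: "analytic_vector_field_on X U" and G: "real_analytic_on G U"
    and XG: "\<forall>z\<in>U. X z $ 2 = z $ 2 * G z"
    and p: "p \<in> U" "p $ 2 = 0" and f1: "partial 1 (\<lambda>z. X z $ 1) p = 0" and Gp: "G p = 0"
    and q: "q $ 2 = 0"
  shows "bt_a X p q = 0"
proof -
  let ?f = "\<lambda>z. X z $ 1"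
  let ?g = "\<lambda>z. partial 1 ?f z * (G z + z $ 2 * partial 2 G z)" and ?h = "\<lambda>z. z $ 2 * (partial 2 ?f z * partial 1 G z)"
  have f: "real_analytic_on ?f U"
    using X unfolding analytic_vector_field_on_def by blast
  have d: "G differentiable (at p)" "partial k G differentiable (at p)" "partial k ?f differentiable (at p)" for k
    using real_analytic_on_differentiable[OF _ p(1)] real_analytic_on_partial[OF _ U] G f by blast+
  note d2 = second_coordinate(1)[of p] and D2 = second_coordinate(2)[of p]
  have dG: "(\<lambda>z. G z + z $ 2 * partial 2 G z) differentiable (at p)"
    and df: "(\<lambda>z. partial 2 ?f z * partial 1 G z) differentiable (at p)"
    by (intro derivative_intros d d2)+
  have DG: "frechet_derivative (\<lambda>z. G z + z $ 2 * partial 2 G z) (at p) q = frechet_derivative G (at p) q"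
  proof -
    have "((\<lambda>z. G z + z $ 2 * partial 2 G z) has_derivative
        (\<lambda>v. frechet_derivative G (at p) v + frechet_derivative (\<lambda>z. z $ 2 * partial 2 G z) (at p) v)) (at p)"
      by (intro has_derivative_add frechet_derivative_works[THEN iffD1] derivative_intros d d2)
    then show ?thesis
      using frechet_derivative_mult[OF d2 d(2), of 2 q] p q D2 by (simp flip: frechet_derivative_at)
  qed
  have det: "det (jacobian X (at z)) = ?g z - ?h z" if "z \<in> U" for z
    using invariant_axis_partials[OF U X G XG that] by (simp add: det_2 jacobian_entry[OF X that])
  have "frechet_derivative (\<lambda>z. det (jacobian X (at z))) (at p) q = frechet_derivative (\<lambda>z. ?g z - ?h z) (at p) q"
    by (subst frechet_derivative_transform_within_open[OF _ U p(1), of "\<lambda>z. ?g z - ?h z"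
          "\<lambda>z. det (jacobian X (at z))", symmetric])
      (auto simp: det intro!: derivative_intros d d2)
  also have "\<dots> = frechet_derivative ?g (at p) q - frechet_derivative ?h (at p) q"
    by (intro frechet_derivative_diff derivative_intros d d2 dG df)
  also have "\<dots> = 0"
    using frechet_derivative_mult[OF d(3) dG, of 1 q] frechet_derivative_mult[OF d2 df, of q]
    by (simp add: f1 Gp p q D2)
  finally show ?thesis
    by (simp add: bt_a_def)
qed

text \<open>
  At the equilibrium the second component \<open>y G\<close> starts in degree \<open>2\<close>, and it contains no \<open>x\<^sup>2\<close> because it
  is divisible by \<open>y\<close>.
\<close>

lemma multiplicity_invariant_axis:
  assumes U: "open U" and X: "analytic_vector_field_on X U" and G: "real_analytic_on G U"
    and XG: "\<forall>z\<in>U. X z $ 2 = z $ 2 * G z"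
    and p: "p \<in> U" "p $ 2 = 0" and Xp: "X p = 0"
    and f1: "partial 1 (\<lambda>z. X z $ 1) p = 0" and f2: "partial 2 (\<lambda>z. X z $ 1) p \<noteq> 0" and Gp: "G p = 0"
  shows "3 \<le> multiplicity_at X p"
proof -
  have an: "real_analytic_on (\<lambda>z. X z $ k) U" for k
    using X unfolding analytic_vector_field_on_def by blast
  obtain F H where F: "has_power_series (\<lambda>z. X z $ 1) p F" and H: "has_power_series (\<lambda>z. X z $ 2) p H"
    using an p(1) unfolding real_analytic_on_def by metis
  note cF = power_series_coeff[OF an U p(1) F] and cH = power_series_coeff[OF an U p(1) H]
  note g = invariant_axis_partials[OF U X G XG]
  have "partial 1 (partial 1 (\<lambda>z. X z $ 2)) p = 0"
  proof -
    note d2 = second_coordinate(1)[of p] and D2 = second_coordinate(2)[of p]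
    have dG: "partial 1 G differentiable (at p)"
      using real_analytic_on_differentiable[OF real_analytic_on_partial[OF G U] p(1)] .
    have "partial 1 (partial 1 (\<lambda>z. X z $ 2)) p = partial 1 (\<lambda>z. z $ 2 * partial 1 G z) p"
      by (rule partial_cong[OF real_analytic_on_differentiable[OF real_analytic_on_partial[OF an U] p(1)] U p(1)]) (simp add: g(1))
    then show ?thesis
      using frechet_derivative_mult[OF d2 dG, of "axis 1 1"] D2 p by (simp add: partial_def axis_def)
  qed
  then show ?thesis
    using multiplicity_ge_3[OF F H] cF(1-3) cH(1-3,6) g[OF p(1)] p Xp f1 f2 Gp by simp
qed

section \<open>Degeneracy of nilpotent equilibria\<close>

theorem theorem6p1:
  fixes U :: "(real^2) set" and X :: "real^2 \<Rightarrow> real^2" and p q\<^sub>0 :: "real^2"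
  assumes "open U" and "0 \<in> U"
    and "analytic_vector_field_on X U"
    and "\<exists>G. real_analytic_on G U \<and> (\<forall>z\<in>U. X z $ 2 = z $ 2 * G z)"
    and "\<exists>I R. real_analytic_on I (U - x_axis) \<and> real_analytic_on R (U - x_axis) \<and>
           first_integral_on I X (U - x_axis) \<and>
           (\<forall>z\<in>U - x_axis. X z = R z *\<^sub>R hamiltonian_field I z \<and> R z \<noteq> 0)"
    and "p isolated_in {z \<in> U. X z = 0}"
    and "nilpotent_map (frechet_derivative X (at p))"
    and "frechet_derivative X (at p) \<noteq> (\<lambda>_. 0)"
    and "spans_kernel X p q\<^sub>0"
  shows "(p \<notin> x_axis \<longrightarrow> bt_b X p q\<^sub>0 = 0) \<and>
         (p \<in> x_axis \<longrightarrow> bt_a X p q\<^sub>0 = 0 \<and> multiplicity_at X p \<ge> 3) \<and>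
         bt_a X p q\<^sub>0 * bt_b X p q\<^sub>0 = 0 \<and>
         \<not> bt_unfolding_versal X p"
proof -
  have p: "p \<in> U" "X p = 0"
    using assms(6) by (auto simp: isolated_in_def)
  have kernel: "frechet_derivative X (at p) q = 0" if "spans_kernel X p q" for q
    using that span_superset[of "{q}"] by (auto simp: spans_kernel_def)
  have off: "bt_b X p q = 0" if "p \<notin> x_axis" "spans_kernel X p q" for q
  proof -
    obtain I R where I: "real_analytic_on I (U - x_axis)" and R: "real_analytic_on R (U - x_axis)"
      and XI: "\<And>z. z \<in> U - x_axis \<Longrightarrow> X z = R z *\<^sub>R hamiltonian_field I z \<and> R z \<noteq> 0"
      using assms(5) by blast
    have "closed x_axis"
      unfolding x_axis_def by (intro closed_Collect_eq continuous_intros)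
    then have "open (U - x_axis)"
      using assms(1) by (rule open_Diff[rotated])
    moreover have "analytic_vector_field_on X (U - x_axis)"
      using assms(3) by (auto simp: analytic_vector_field_on_def real_analytic_on_def)
    ultimately show ?thesis
      using bt_b_conformally_hamiltonian[OF _ _ _ I R] XI p that kernel by blast
  qed
  have on: "bt_a X p q = 0 \<and> multiplicity_at X p \<ge> 3" if "p \<in> x_axis" "spans_kernel X p q" for q
  proof -
    obtain G where G: "real_analytic_on G U" and XG: "\<forall>z\<in>U. X z $ 2 = z $ 2 * G z"
      using assms(4) by blast
    have p2: "p $ 2 = 0"
      using that by (simp add: x_axis_def)
    note nil = invariant_axis_nilpotent[OF assms(1,3) G XG p(1) p2 assms(7,8)]
    have "(\<lambda>z. X z $ 1) differentiable (at p)"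
      using assms(3) p(1) real_analytic_on_differentiable unfolding analytic_vector_field_on_def by blast
    then have "q $ 2 = 0"
      using frechet_derivative_component[OF assms(3) p(1), of q 1] kernel[OF that(2)] nil(1,3)
      by (simp add: frechet_derivative_partial)
    then show ?thesis
      using bt_a_invariant_axis[OF assms(1,3) G XG p(1) p2 nil(1,2)]
        multiplicity_invariant_axis[OF assms(1,3) G XG p(1) p2 p(2) nil(1,3,2)] by blast
  qed
  have "bt_a X p q * bt_b X p q = 0" if "spans_kernel X p q" for q
    using on off that by (cases "p \<in> x_axis") auto
  then show ?thesis
    using on off assms(9) by (auto simp: bt_unfolding_versal_def)
qed

end
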